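(* Let $n\ge 1$ be an integer and let $X_1,\ldots,X_n$ be independent nonnegative real-valued random variables, each with expectation $\mathbb{E}(X_i)=1$. Then, for every real $\delta$ with $0<\delta\leq 1$, \[ \mathbb{P}\left(\sum_{i=1}^n X_i<n+\delta\right)\geq \delta\left(\frac{n}{n+\delta}\right)^n. \] *)

theory Defs
  imports "HOL-Probability.Probability"
begin

end

theory Submission
  imports Defs "HOL-Real_Asymp.Real_Asymp"
begin

text \<open>
  The probability is linear in each law, so every \<open>X\<^sub>i\<close> may be assumed to take two values
  \<open>a\<^sub>i\<close> and \<open>a\<^sub>i + b\<^sub>i\<close>. Subtracting \<open>a\<^sub>i\<close> leaves independent variables with values in \<open>{0, b\<^sub>i}\<close>
  and means at most \<open>1\<close>, and the threshold \<open>T = \<delta> + \<Sum> E X\<^sub>i\<close> for their sum \<open>S\<close>.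

  Tilt the product law by \<open>e\<^sup>-\<^sup>t\<^sup>S\<close>, with \<open>t\<close> going from \<open>0\<close> to infinity. Let \<open>p\<close> be the probability of
  \<open>S < T\<close> and \<open>q = E(T - S | S < T)\<close>. Then \<open>(log p)' = \<Sum> x\<^sub>i\<close> with \<open>x\<^sub>i = E X\<^sub>i - E(X\<^sub>i | S < T) \<ge> 0\<close>,
  \<open>q' = Var(S | S < T) \<ge> 0\<close> and \<open>(E X\<^sub>i)' = - Var X\<^sub>i\<close>, while
  \<open>p q = E(T - S)\<^sup>+ \<ge> T - \<Sum> E X\<^sub>i\<close>. Put \<open>1 + c\<^sub>i = exp (\<integral> x\<^sub>i)\<close>, so that \<open>p(t) = p(0) \<Prod> (1 + c\<^sub>i)\<close>. The
  inequality \<open>Var X\<^sub>i \<ge> (q - E X\<^sub>i) x\<^sub>i + Cov(X\<^sub>i, S | S < T)\<close> and a lower bound for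
  these covariances in terms of \<open>Var(S | S < T)\<close> imply, if \<open>q(0) \<ge> 1 + \<delta>\<close>, that the means have dropped by at
  least \<open>(q - 1) \<Sum> c\<^sub>i\<close> in total as long as \<open>\<Sum> c\<^sub>i \<le> \<delta>\<close>. When \<open>\<Sum> c\<^sub>i = \<delta>\<close> this says
  \<open>p q \<ge> \<delta> + (q - 1) \<delta> = \<delta> q\<close>, hence \<open>p(t) \<ge> \<delta>\<close> and, by the inequality of arithmetic and geometric
  means, \<open>p(0) \<ge> \<delta> / \<Prod> (1 + c\<^sub>i) \<ge> \<delta> / (1 + \<delta> / n)\<^sup>n\<close>.
  If \<open>q(0) < 1 + \<delta>\<close>, then already \<open>p(0) \<ge> \<delta> / q(0)\<close> suffices.
\<close>

section \<open>One two-point variable\<close>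

text \<open>
  Here \<open>W = T - S + X\<^sub>i\<close> with law \<open>R\<close>, and \<open>X\<^sub>i\<close> is \<open>0\<close> or \<open>b\<close> with weights \<open>g\<close> and \<open>f\<close>. Up to
  normalisation the claim reads \<open>- (q - E X\<^sub>i) Cov(X\<^sub>i, S | S < T) \<le> E X\<^sub>i Var(S | S < T)\<close>. The variance
  is bounded from below by the variance between the three blocks \<open>X\<^sub>i = 0, W \<le> b\<close>; \<open>X\<^sub>i = 0, W > b\<close>;
  \<open>X\<^sub>i = b\<close>, whose conditional means of \<open>T - S - q\<close> are \<open>-A\<close>, \<open>D + b\<close> and \<open>D\<close>.
\<close>

lemma two_point_covariance_bound:
  fixes R W :: "'j \<Rightarrow> real"
  assumes "finite J" and R: "\<And>j. j \<in> J \<Longrightarrow> R j \<ge> 0"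
    and b: "b > 0" and f: "f \<ge> 0" and g: "g > 0"
    and center: "(\<Sum>j\<in>J. R j * (g * (if W j > 0 then W j - q else 0)
                     + f * (if W j > b then W j - b - q else 0))) = 0"
    and pos: "b * f \<le> q * (f + g)"
  shows "(q * (f + g) - b * f) * (\<Sum>j\<in>J. R j * (if W j > b then W j - b - q else 0))
      \<le> (\<Sum>j\<in>J. R j * (g * (if W j > 0 then (W j - q)\<^sup>2 else 0)
                     + f * (if W j > b then (W j - b - q)\<^sup>2 else 0)))" (is "_ \<le> ?V")
proof -
  define l where "l = (\<Sum>j\<in>J. R j * (if W j > b then 1 else 0))"
  define k where "k = (\<Sum>j\<in>J. R j * (if W j > 0 \<and> W j \<le> b then 1 else 0))"
  define E where "E = (\<Sum>j\<in>J. R j * (if W j > b then W j - b - q else 0))"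
  define e where "e = (\<Sum>j\<in>J. R j * (if W j > 0 \<and> W j \<le> b then W j - q else 0))"
  have l0: "l \<ge> 0" and k0: "k \<ge> 0"
    unfolding l_def k_def by (auto intro!: sum_nonneg R)
  have V0: "?V \<ge> 0"
    using f g by (auto intro!: sum_nonneg mult_nonneg_nonneg R)
  have e_le: "e \<le> (b - q) * k"
    unfolding e_def k_def sum_distrib_left
    by (intro sum_mono) (auto simp: R mult.commute[of _ "R _"] intro!: mult_left_mono)
  have "(\<Sum>j\<in>J. R j * (g * (if W j > 0 then W j - q else 0)
                     + f * (if W j > b then W j - b - q else 0)))
     = g * e + g * (E + b * l) + f * E"
    unfolding e_def E_def l_def sum_distrib_left sum.distrib[symmetric]
    by (rule sum.cong) (use b in \<open>auto simp: algebra_simps\<close>)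
  then have bal: "g * e + g * (E + b * l) + f * E = 0"
    using center by simp
  show ?thesis
  proof (cases "E > 0")
    case False
    then have "(q * (f + g) - b * f) * E \<le> 0"
      using pos by (intro mult_nonneg_nonpos) auto
    then show ?thesis
      using V0 unfolding E_def by linarith
  next
    case True
    have lpos: "l > 0"
    proof (rule ccontr)
      assume "\<not> l > 0"
      then have "l = 0" using l0 by simp
      then have "\<forall>j\<in>J. R j * (if W j > b then 1 else 0) = 0"
        unfolding l_def using \<open>finite J\<close> R by (subst (asm) sum_nonneg_eq_0_iff) auto
      then have "E = 0"
        unfolding E_def by (intro sum.neutral) auto
      then show False using True by simp
    qed
    define D where "D = E / l"
    have E: "E = D * l" and D: "D > 0"
      using lpos True by (auto simp: D_def)
    have ge: "g * e = - (l * (g * (D + b) + f * D))"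
      using bal unfolding E by (simp add: algebra_simps)
    have "l * (g * (D + b) + f * D) > 0"
      using lpos g D b f by (intro mult_pos_pos add_pos_nonneg) auto
    then have "g * e < 0"
      using ge by linarith
    then have eneg: "e < 0"
      using g by (simp add: mult_less_0_iff)
    have "k > 0"
    proof (rule ccontr)
      assume "\<not> k > 0"
      then have "k = 0" using k0 by simp
      then have "\<forall>j\<in>J. R j * (if W j > 0 \<and> W j \<le> b then 1 else 0) = 0"
        unfolding k_def using \<open>finite J\<close> R by (subst (asm) sum_nonneg_eq_0_iff) auto
      then have "e = 0"
        unfolding e_def by (intro sum.neutral) auto
      then show False using eneg by simp
    qed
    define A where "A = - e / k"
    have e: "e = - A * k" 
      using \<open>k > 0\<close> by (simp add: A_def)
    have A: "q - b \<le> A"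
    proof -
      have "(q - b) * k \<le> A * k"
        using e_le unfolding e by (simp add: algebra_simps)
      then show ?thesis using \<open>k > 0\<close> by simp
    qed
    have Ak: "g * k * A = l * (g * (D + b) + f * D)"
      using ge unfolding e by (simp add: algebra_simps)
    \<comment> \<open>On each block a square lies above its tangent at the block mean
      \<open>-A\<close>, \<open>D + b\<close> or \<open>D\<close>; summing the tangents gives the
      variance between the blocks.\<close>
    have "g * (-2 * A * e - A\<^sup>2 * k) + g * (2 * (D + b) * (E + b * l) - (D + b)\<^sup>2 * l)
        + f * (2 * D * E - D\<^sup>2 * l) \<le> ?V"
    proof -
      have tangent: "2 * c * z - c\<^sup>2 \<le> z\<^sup>2" for c z :: real
        using zero_le_power2[of "z - c"] by (simp add: power2_eq_square algebra_simps)
      have "g * (-2 * A * e - A\<^sup>2 * k) + g * (2 * (D + b) * (E + b * l) - (D + b)\<^sup>2 * l)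
          + f * (2 * D * E - D\<^sup>2 * l)
        = (\<Sum>j\<in>J. R j * (g * (if W j > b then 2 * (D + b) * (W j - q) - (D + b)\<^sup>2
             else if W j > 0 then 2 * (- A) * (W j - q) - (- A)\<^sup>2 else 0)
           + f * (if W j > b then 2 * D * (W j - b - q) - D\<^sup>2 else 0)))"
        unfolding e_def E_def l_def k_def
        by (simp only: sum_distrib_left sum_subtractf[symmetric] sum.distrib[symmetric])
          (rule sum.cong, auto simp: algebra_simps)
      also have "\<dots> \<le> ?V"
      proof (rule sum_mono)
        fix j assume j: "j \<in> J"
        show "R j * (g * (if W j > b then 2 * (D + b) * (W j - q) - (D + b)\<^sup>2
             else if W j > 0 then 2 * (- A) * (W j - q) - (- A)\<^sup>2 else 0)
           + f * (if W j > b then 2 * D * (W j - b - q) - D\<^sup>2 else 0))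
          \<le> R j * (g * (if W j > 0 then (W j - q)\<^sup>2 else 0)
                     + f * (if W j > b then (W j - b - q)\<^sup>2 else 0))"
          using tangent[of "D + b" "W j - q"] tangent[of "- A" "W j - q"]
            tangent[of D "W j - b - q"] b f g R[OF j]
          by (intro mult_left_mono add_mono) auto
      qed
      finally show ?thesis .
    qed
    also have "g * (-2 * A * e - A\<^sup>2 * k) + g * (2 * (D + b) * (E + b * l) - (D + b)\<^sup>2 * l)
        + f * (2 * D * E - D\<^sup>2 * l) = A * (g * k * A) + l * (g * (D + b)\<^sup>2 + f * D\<^sup>2)"
      unfolding e E by (simp add: algebra_simps power2_eq_square)
    also have "\<dots> = l * (A * (g * (D + b) + f * D) + g * (D + b)\<^sup>2 + f * D\<^sup>2)"
      unfolding Ak by (simp add: algebra_simps)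
    finally have V: "l * (A * (g * (D + b) + f * D) + g * (D + b)\<^sup>2 + f * D\<^sup>2) \<le> ?V" .
    have A0: "A \<ge> 0"
      using eneg \<open>k > 0\<close> by (simp add: A_def divide_le_0_iff)
    \<comment> \<open>Once \<open>q\<close> is replaced by the larger \<open>A + b\<close>, the two
      sides differ by a sum of nonnegative terms.\<close>
    have "(q * (f + g) - b * f) * D \<le> ((A + b) * (f + g) - b * f) * D"
      using A f g D by (intro mult_right_mono diff_right_mono) auto
    also have "\<dots> \<le> A * (g * (D + b) + f * D) + g * (D + b)\<^sup>2 + f * D\<^sup>2"
    proof -
      have "0 \<le> A * g * b + g * (D\<^sup>2 + D * b + b\<^sup>2) + f * D\<^sup>2"
        using A0 g b D f by (intro add_nonneg_nonneg mult_nonneg_nonneg) auto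
      then show ?thesis by (simp add: algebra_simps power2_eq_square)
    qed
    finally have "l * ((q * (f + g) - b * f) * D) \<le> ?V"
      using V l0 by (meson mult_left_mono order_trans)
    then show ?thesis
      unfolding E_def[symmetric] E by (simp add: mult_ac)
  qed
qed

section \<open>Exponentially tilted product laws\<close>

locale two_point_tilt =
  fixes N :: "'i set" and b s :: "'i \<Rightarrow> real" and T :: real
  assumes finite_N: "finite N"
    and b_pos: "\<And>i. i \<in> N \<Longrightarrow> b i > 0"
    and s_nonneg: "\<And>i. i \<in> N \<Longrightarrow> s i \<ge> 0"
    and s_less: "\<And>i. i \<in> N \<Longrightarrow> s i < 1"
    and T_pos: "T > 0"
begin

text \<open>
  A subset \<open>I\<close> of \<open>N\<close> stands for the outcome in which exactly the variables with index in \<open>I\<close> take their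
  value \<open>b\<close> rather than \<open>0\<close>. The tilted weights \<open>U t\<close> are not normalised: their total mass is the
  product of the \<open>f t i + (1 - s i)\<close>.
\<close>

definition f :: "real \<Rightarrow> 'i \<Rightarrow> real" where
  "f t i = s i * exp (- (t * b i))"

definition U :: "real \<Rightarrow> 'i set \<Rightarrow> real" where
  "U t I = (\<Prod>i\<in>I. f t i) * (\<Prod>i\<in>N - I. 1 - s i)"

definition A :: "'i set set" where
  "A = {I \<in> Pow N. sum b I < T}"

definition mass :: "real \<Rightarrow> real" where
  "mass t = (\<Sum>I\<in>A. U t I)"

definition cond :: "real \<Rightarrow> ('i set \<Rightarrow> real) \<Rightarrow> real" where
  "cond t h = (\<Sum>I\<in>A. U t I * h I) / mass t"

definition X :: "'i \<Rightarrow> 'i set \<Rightarrow> real" where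
  "X i I = (if i \<in> I then b i else 0)"

definition mean :: "real \<Rightarrow> 'i \<Rightarrow> real" where
  "mean t i = b i * f t i / (f t i + (1 - s i))"

text \<open>In the notation of the introduction \<open>slack\<close> is \<open>q\<close> and
  \<open>gap t i\<close> is \<open>x\<^sub>i\<close>; the later \<open>below\<close> and
  \<open>E i t\<close> are \<open>p\<close> and \<open>1 + c\<^sub>i\<close>.\<close>

definition slack :: "real \<Rightarrow> real" where
  "slack t = cond t (\<lambda>I. T - sum b I)"

definition gap :: "real \<Rightarrow> 'i \<Rightarrow> real" where
  "gap t i = mean t i - cond t (X i)"

definition var :: "real \<Rightarrow> real" where
  "var t = cond t (\<lambda>I. (T - sum b I - slack t)\<^sup>2)"

text \<open>Conditional covariance of \<open>X i\<close> with the sum: the second factor is minus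
  the centred sum, whence the sign.\<close>

definition cov :: "real \<Rightarrow> 'i \<Rightarrow> real" where
  "cov t i = - cond t (\<lambda>I. X i I * (T - sum b I - slack t))"

definition below :: "real \<Rightarrow> real" where
  "below t = mass t / (\<Prod>i\<in>N. f t i + (1 - s i))"

section \<open>Positivity of the weights and linearity of the conditional expectation\<close>

lemma f_nonneg: "i \<in> N \<Longrightarrow> f t i \<ge> 0"
  by (simp add: f_def s_nonneg)

lemma norm_pos: "i \<in> N \<Longrightarrow> f t i + (1 - s i) > 0"
  using f_nonneg[of i t] s_less[of i] by linarith

lemma finite_A: "finite A"
  unfolding A_def using finite_N by simp

lemma A_subset: "I \<in> A \<Longrightarrow> I \<subseteq> N"
  by (simp add: A_def)

lemma U_nonneg: "I \<subseteq> N \<Longrightarrow> U t I \<ge> 0"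
  unfolding U_def by (intro mult_nonneg_nonneg prod_nonneg) (auto intro: f_nonneg less_imp_le s_less)

lemma U_empty_pos: "U t {} > 0"
  unfolding U_def by (auto intro!: prod_pos simp: s_less)

lemma empty_in_A: "{} \<in> A"
  by (simp add: A_def T_pos)

lemma mass_pos: "mass t > 0"
  unfolding mass_def
  by (rule sum_pos2[where i = "{}"]) (auto simp: finite_A empty_in_A U_empty_pos intro: U_nonneg dest: A_subset)

lemma cond_add: "cond t (\<lambda>I. h I + k I) = cond t h + cond t k"
  by (simp add: cond_def distrib_left sum.distrib add_divide_distrib)

lemma cond_diff: "cond t (\<lambda>I. h I - k I) = cond t h - cond t k"
  by (simp add: cond_def right_diff_distrib sum_subtractf diff_divide_distrib)

lemma cond_cmult: "cond t (\<lambda>I. c * h I) = c * cond t h"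
  by (simp add: cond_def mult.left_commute[of _ c] sum_distrib_left[symmetric])

lemma cond_const: "cond t (\<lambda>I. c) = c"
  using mass_pos[of t] by (simp add: cond_def mass_def sum_distrib_right[symmetric])

lemma cond_sum: "cond t (\<lambda>I. \<Sum>i\<in>K. h i I) = (\<Sum>i\<in>K. cond t (h i))"
  by (subst (1 2) cond_def)
    (simp add: sum_distrib_left sum.swap[of _ K] sum_divide_distrib)

lemma cond_cong: "(\<And>I. I \<in> A \<Longrightarrow> h I = k I) \<Longrightarrow> cond t h = cond t k"
  by (simp add: cond_def cong: sum.cong)

lemma cond_nonneg: "(\<And>I. I \<in> A \<Longrightarrow> h I \<ge> 0) \<Longrightarrow> cond t h \<ge> 0"
  unfolding cond_def using mass_pos[of t]
  by (intro divide_nonneg_pos sum_nonneg mult_nonneg_nonneg) (auto intro: U_nonneg dest: A_subset)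

lemma sum_X: "I \<subseteq> N \<Longrightarrow> (\<Sum>i\<in>N. X i I) = sum b I"
  unfolding X_def using finite_N by (simp add: sum.If_cases Int_absorb1)

lemma cond_sum_b: "cond t (\<lambda>I. sum b I) = T - slack t"
  by (simp add: slack_def cond_diff cond_const)

lemma sum_cond_X: "(\<Sum>i\<in>N. cond t (X i)) = T - slack t"
proof -
  have "(\<Sum>i\<in>N. cond t (X i)) = cond t (\<lambda>I. \<Sum>i\<in>N. X i I)"
    by (simp add: cond_sum)
  also have "\<dots> = cond t (\<lambda>I. sum b I)"
    by (rule cond_cong) (simp add: sum_X A_subset)
  finally show ?thesis by (simp add: cond_sum_b)
qed

lemma var_nonneg: "var t \<ge> 0"
  unfolding var_def by (rule cond_nonneg) simp

lemma cond_centered: "cond t (\<lambda>I. T - sum b I - slack t) = 0"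
  by (simp add: cond_diff cond_const slack_def)

lemma var_eq: "var t = - cond t (\<lambda>I. sum b I * (T - sum b I - slack t))"
proof -
  have "var t + cond t (\<lambda>I. sum b I * (T - sum b I - slack t))
    = cond t (\<lambda>I. (T - slack t) * (T - sum b I - slack t))"
    unfolding var_def cond_add[symmetric]
    by (rule cond_cong) (simp add: power2_eq_square algebra_simps)
  then show ?thesis by (simp only: cond_cmult cond_centered)
qed

lemma sum_cov: "(\<Sum>i\<in>N. cov t i) = var t"
proof -
  have "(\<Sum>i\<in>N. cov t i) = - cond t (\<lambda>I. \<Sum>i\<in>N. X i I * (T - sum b I - slack t))"
    unfolding cov_def by (simp add: cond_sum sum_negf)
  also have "cond t (\<lambda>I. \<Sum>i\<in>N. X i I * (T - sum b I - slack t))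
      = cond t (\<lambda>I. sum b I * (T - sum b I - slack t))"
    by (rule cond_cong) (simp add: sum_X A_subset sum_distrib_right[symmetric])
  finally show ?thesis by (simp add: var_eq)
qed

section \<open>Isolating one variable\<close>

text \<open>\<open>R t i\<close> is the weight of the variables other than the \<open>i\<close>-th.\<close>

definition R :: "real \<Rightarrow> 'i \<Rightarrow> 'i set \<Rightarrow> real" where
  "R t i J = (\<Prod>j\<in>J. f t j) * (\<Prod>j\<in>N - {i} - J. 1 - s j)"

lemma R_nonneg: "J \<subseteq> N - {i} \<Longrightarrow> R t i J \<ge> 0"
  unfolding R_def
  by (intro mult_nonneg_nonneg prod_nonneg) (auto intro: f_nonneg less_imp_le s_less)

lemma sum_Pow_split:
  assumes i: "i \<in> N"
  shows "(\<Sum>I\<in>Pow N. U t I * h I)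
    = (\<Sum>J\<in>Pow (N - {i}). R t i J * ((1 - s i) * h J + f t i * h (insert i J)))"
proof -
  let ?M = "N - {i}"
  have fin: "finite ?M" using finite_N by simp
  have N: "N = insert i ?M" using i by auto
  have inj: "inj_on (insert i) (Pow ?M)"
    by (auto simp: inj_on_def)
  have out: "U t J = R t i J * (1 - s i)" if "J \<in> Pow ?M" for J
  proof -
    have "N - J = insert i (?M - J)" using i that by auto
    then show ?thesis using fin by (simp add: U_def R_def mult_ac)
  qed
  have ins: "U t (insert i J) = R t i J * f t i" if "J \<in> Pow ?M" for J
  proof -
    have "N - insert i J = ?M - J" "i \<notin> J" "finite J"
      using that fin by (auto intro: finite_subset)
    then show ?thesis by (simp add: U_def R_def mult_ac)
  qed
  have "(\<Sum>I\<in>Pow N. U t I * h I)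
      = (\<Sum>I\<in>Pow ?M \<union> insert i ` Pow ?M. U t I * h I)"
    by (subst N, subst Pow_insert) simp
  also have "\<dots> = (\<Sum>J\<in>Pow ?M. U t J * h J) + (\<Sum>I\<in>insert i ` Pow ?M. U t I * h I)"
    using fin by (intro sum.union_disjoint) auto
  also have "(\<Sum>I\<in>insert i ` Pow ?M. U t I * h I) = (\<Sum>J\<in>Pow ?M. U t (insert i J) * h (insert i J))"
    by (simp add: sum.reindex[OF inj])
  finally have "(\<Sum>I\<in>Pow N. U t I * h I)
      = (\<Sum>J\<in>Pow ?M. U t J * h J + U t (insert i J) * h (insert i J))"
    by (simp add: sum.distrib)
  also have "\<dots> = (\<Sum>J\<in>Pow ?M. R t i J * ((1 - s i) * h J + f t i * h (insert i J)))"
    by (rule sum.cong) (simp_all add: out ins distrib_left)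
  finally show ?thesis .
qed

text \<open>\<open>T - sum b J\<close> is the room left for the \<open>i\<close>-th variable: the
  value 0 fits iff it is positive, the value \<open>b i\<close> iff it exceeds
  \<open>b i\<close>.\<close>

lemma sum_A_split:
  assumes i: "i \<in> N"
  shows "(\<Sum>I\<in>A. U t I * h I)
    = (\<Sum>J\<in>Pow (N - {i}). R t i J * ((1 - s i) * (if T - sum b J > 0 then h J else 0)
         + f t i * (if T - sum b J > b i then h (insert i J) else 0)))"
proof -
  have "(\<Sum>I\<in>A. U t I * h I) = (\<Sum>I\<in>Pow N. U t I * (if sum b I < T then h I else 0))"
    unfolding A_def using finite_N
    by (subst sum.inter_filter[of "Pow N"]) (auto intro!: sum.cong)
  also have "\<dots> = (\<Sum>J\<in>Pow (N - {i}). R t i J * ((1 - s i) * (if sum b J < T then h J else 0)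
       + f t i * (if sum b (insert i J) < T then h (insert i J) else 0)))"
    by (rule sum_Pow_split[OF i])
  also have "\<dots> = (\<Sum>J\<in>Pow (N - {i}). R t i J * ((1 - s i) * (if T - sum b J > 0 then h J else 0)
         + f t i * (if T - sum b J > b i then h (insert i J) else 0)))"
  proof (rule sum.cong[OF refl])
    fix J assume "J \<in> Pow (N - {i})"
    then have "finite J" "i \<notin> J" using finite_N by (auto intro: finite_subset)
    then have "sum b (insert i J) = b i + sum b J" by simp
    then show "R t i J * ((1 - s i) * (if sum b J < T then h J else 0)
       + f t i * (if sum b (insert i J) < T then h (insert i J) else 0))
      = R t i J * ((1 - s i) * (if T - sum b J > 0 then h J else 0)
         + f t i * (if T - sum b J > b i then h (insert i J) else 0))"
      by auto
  qed
  finally show ?thesis .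
qed

lemma sum_insert_b: "i \<in> N \<Longrightarrow> J \<in> Pow (N - {i}) \<Longrightarrow> sum b (insert i J) = b i + sum b J"
  using finite_N by (subst sum.insert) (auto intro: finite_subset[of J N])

text \<open>The larger value is less compatible with the event (\<open>P1 \<le> P0\<close>), so
  conditioning cannot raise the probability of \<open>b i\<close>.\<close>

lemma gap_nonneg:
  assumes i: "i \<in> N"
  shows "gap t i \<ge> 0"
proof -
  let ?g = "1 - s i" and ?f = "f t i"
  let ?J = "Pow (N - {i})" and ?W = "\<lambda>J. T - sum b J"
  define P0 where "P0 = (\<Sum>J\<in>?J. R t i J * (if ?W J > 0 then 1 else 0))"
  define P1 where "P1 = (\<Sum>J\<in>?J. R t i J * (if ?W J > b i then 1 else 0))"
  have "P1 \<le> P0"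
    unfolding P0_def P1_def using b_pos[OF i]
    by (intro sum_mono mult_left_mono R_nonneg) auto
  have mass: "mass t = ?g * P0 + ?f * P1"
    using sum_A_split[OF i, of t "\<lambda>_. 1"]
    unfolding mass_def P0_def P1_def
    by (simp add: sum_distrib_left sum.distrib[symmetric] algebra_simps)
  have X: "(\<Sum>I\<in>A. U t I * X i I) = ?f * b i * P1"
    unfolding sum_A_split[OF i] P1_def sum_distrib_left
    by (rule sum.cong) (auto simp: X_def)
  have "P1 * (?f + ?g) \<le> mass t"
    unfolding mass using mult_left_mono[OF \<open>P1 \<le> P0\<close>, of ?g] s_less[OF i]
    by (simp add: algebra_simps)
  then have "P1 / mass t \<le> 1 / (?f + ?g)"
    using mass_pos[of t] norm_pos[OF i, of t] by (simp add: field_simps)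
  then have "b i * ?f * (P1 / mass t) \<le> b i * ?f * (1 / (?f + ?g))"
    using b_pos[OF i] f_nonneg[OF i, of t] by (intro mult_left_mono) auto
  then show ?thesis
    unfolding gap_def mean_def cond_def X by (simp add: mult_ac)
qed

text \<open>Expanding \<open>gap\<close> and \<open>cov\<close> reduces the claim to
  \<open>mean t i * (slack t + y - b i) \<le> z\<close>. This comes from bounding
  \<open>w - b i\<close> by its positive part for every \<open>w > 0\<close>.\<close>

lemma variance_lower_bound:
  assumes i: "i \<in> N"
  shows "mean t i * (b i - mean t i) \<ge> (slack t - mean t i) * gap t i + cov t i"
proof -
  let ?g = "1 - s i" and ?f = "f t i" and ?b = "b i"
  let ?J = "Pow (N - {i})" and ?W = "\<lambda>J. T - sum b J"
  define P0 where "P0 = (\<Sum>J\<in>?J. R t i J * (if ?W J > 0 then 1 else 0))"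
  define P1 where "P1 = (\<Sum>J\<in>?J. R t i J * (if ?W J > b i then 1 else 0))"
  define E0 where "E0 = (\<Sum>J\<in>?J. R t i J * (if ?W J > 0 then ?W J else 0))"
  define E1 where "E1 = (\<Sum>J\<in>?J. R t i J * (if ?W J > b i then ?W J - b i else 0))"
  define y where "y = cond t (X i)"
  define z where "z = cond t (\<lambda>I. X i I * (T - sum b I))"
  have E: "E0 - ?b * P0 \<le> E1"
    unfolding E0_def E1_def P0_def sum_distrib_left sum_subtractf[symmetric]
  proof (rule sum_mono)
    fix J assume "J \<in> ?J"
    then have "R t i J \<ge> 0" by (simp add: R_nonneg)
    then have "R t i J * (if ?W J > 0 then ?W J - ?b else 0)
        \<le> R t i J * (if ?W J > ?b then ?W J - ?b else 0)"
      using b_pos[OF i] by (intro mult_left_mono) auto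
    then show "R t i J * (if ?W J > 0 then ?W J else 0) - ?b * (R t i J * (if ?W J > 0 then 1 else 0))
        \<le> R t i J * (if ?W J > ?b then ?W J - ?b else 0)"
      by (auto simp: algebra_simps split: if_splits)
  qed
  have mass: "mass t = ?g * P0 + ?f * P1"
    using sum_A_split[OF i, of t "\<lambda>_. 1"]
    unfolding mass_def P0_def P1_def
    by (simp add: sum_distrib_left sum.distrib[symmetric] algebra_simps)
  have y: "mass t * y = ?f * ?b * P1"
  proof -
    have "(\<Sum>I\<in>A. U t I * X i I) = ?f * ?b * P1"
      unfolding sum_A_split[OF i] P1_def sum_distrib_left
      by (rule sum.cong) (auto simp: X_def)
    then show ?thesis using mass_pos[of t] by (simp add: y_def cond_def)
  qed
  have q: "mass t * slack t = ?g * E0 + ?f * E1"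
  proof -
    have "(\<Sum>I\<in>A. U t I * (T - sum b I)) = ?g * E0 + ?f * E1"
      unfolding sum_A_split[OF i] E0_def E1_def sum_distrib_left sum.distrib[symmetric]
      by (rule sum.cong) (auto simp: sum_insert_b[OF i] algebra_simps)
    then show ?thesis using mass_pos[of t] by (simp add: slack_def cond_def)
  qed
  have z: "mass t * z = ?f * ?b * E1"
  proof -
    have "(\<Sum>I\<in>A. U t I * (X i I * (T - sum b I))) = ?f * ?b * E1"
      unfolding sum_A_split[OF i] E1_def sum_distrib_left
      by (rule sum.cong) (auto simp: X_def sum_insert_b[OF i] algebra_simps)
    then show ?thesis using mass_pos[of t] by (simp add: z_def cond_def)
  qed
  have cov: "cov t i = slack t * y - z"
    unfolding cov_def y_def z_def right_diff_distrib cond_diff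
    by (simp add: mult.commute[of _ "slack t"] cond_cmult)
  \<comment> \<open>This is \<open>E\<close> times \<open>1 - s i\<close>, with
    \<open>f t i * E1\<close> added on both sides.\<close>
  have "mass t * (slack t + y - ?b) \<le> (?f + ?g) * E1"
    using mult_left_mono[OF E, of ?g] s_less[OF i]
    by (simp add: ring_distribs q y) (simp add: mass algebra_simps)
  then have "?b * ?f * (mass t * (slack t + y - ?b)) \<le> ?b * ?f * ((?f + ?g) * E1)"
    using b_pos[OF i] f_nonneg[OF i, of t] by (intro mult_left_mono) auto
  also have "\<dots> = mass t * ((?f + ?g) * z)"
    using z by (simp add: mult_ac)
  finally have "mass t * (?b * ?f * (slack t + y - ?b)) \<le> mass t * ((?f + ?g) * z)"
    by (simp add: mult_ac)
  then have "?b * ?f * (slack t + y - ?b) \<le> (?f + ?g) * z"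
    using mass_pos[of t] by simp
  then have "mean t i * (slack t + y - ?b) \<le> z"
    using norm_pos[OF i, of t] by (simp add: mean_def field_simps)
  then show ?thesis
    unfolding cov gap_def y_def[symmetric] by (simp add: algebra_simps)
qed

text \<open>\<open>two_point_covariance_bound\<close> is applied with \<open>W\<close> the room left
  by the other variables. Multiplication by \<open>mean t i\<close> turns
  \<open>(f t i + (1 - s i)) * E\<close> into \<open>- mass t * cov t i\<close>.\<close>

lemma covariance_lower_bound:
  assumes i: "i \<in> N" and le: "mean t i \<le> slack t"
  shows "(slack t - mean t i) * - cov t i \<le> mean t i * var t"
proof -
  let ?g = "1 - s i" and ?f = "f t i" and ?b = "b i" and ?q = "slack t"
  let ?J = "Pow (N - {i})" and ?W = "\<lambda>J. T - sum b J"
  let ?Z = "\<lambda>I. T - sum b I - ?q"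
  define E where "E = (\<Sum>J\<in>?J. R t i J * (if ?W J > ?b then ?W J - ?b - ?q else 0))"
  define V where "V = (\<Sum>J\<in>?J. R t i J * (?g * (if ?W J > 0 then (?W J - ?q)\<^sup>2 else 0)
                     + ?f * (if ?W J > ?b then (?W J - ?b - ?q)\<^sup>2 else 0)))"
  have pos: "?f + ?g > 0" by (rule norm_pos[OF i])
  have center: "(\<Sum>J\<in>?J. R t i J * (?g * (if ?W J > 0 then ?W J - ?q else 0)
                     + ?f * (if ?W J > ?b then ?W J - ?b - ?q else 0))) = 0"
  proof -
    have "(\<Sum>I\<in>A. U t I * ?Z I) = 0"
      using cond_centered[of t] mass_pos[of t] by (simp add: cond_def)
    moreover have "(\<Sum>I\<in>A. U t I * ?Z I)
      = (\<Sum>J\<in>?J. R t i J * (?g * (if ?W J > 0 then ?W J - ?q else 0)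
                     + ?f * (if ?W J > ?b then ?W J - ?b - ?q else 0)))"
      unfolding sum_A_split[OF i]
      by (rule sum.cong) (auto simp: sum_insert_b[OF i] algebra_simps)
    ultimately show ?thesis by simp
  qed
  have "?b * ?f \<le> ?q * (?f + ?g)"
    using le pos by (simp add: mean_def field_simps)
  then have "(?q * (?f + ?g) - ?b * ?f) * E \<le> V"
    unfolding E_def V_def using finite_N b_pos[OF i] f_nonneg[OF i] s_less[OF i] center
    by (intro two_point_covariance_bound) (auto intro: R_nonneg)
  moreover have "?q * (?f + ?g) - ?b * ?f = (?f + ?g) * (?q - mean t i)"
    using pos by (simp add: mean_def field_simps)
  ultimately have "(?f + ?g) * (?q - mean t i) * E \<le> V" by simp
  then have "mean t i * ((?f + ?g) * (?q - mean t i) * E) \<le> mean t i * V"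
    using b_pos[OF i] f_nonneg[OF i, of t] pos by (intro mult_left_mono) (auto simp: mean_def)
  moreover have "mean t i * (?f + ?g) = ?b * ?f"
    using pos by (simp add: mean_def)
  ultimately have "(?q - mean t i) * (?b * ?f * E) \<le> mean t i * V"
    by (metis mult.assoc mult.commute)
  moreover have "mass t * - cov t i = ?b * ?f * E"
  proof -
    have "(\<Sum>I\<in>A. U t I * (X i I * ?Z I)) = ?b * ?f * E"
      unfolding sum_A_split[OF i] E_def sum_distrib_left
      by (rule sum.cong) (auto simp: X_def sum_insert_b[OF i] algebra_simps)
    then show ?thesis using mass_pos[of t] by (simp add: cov_def cond_def)
  qed
  moreover have "mass t * var t = V"
  proof -
    have "(\<Sum>I\<in>A. U t I * (?Z I)\<^sup>2) = V"
      unfolding sum_A_split[OF i] V_def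
      by (rule sum.cong) (auto simp: sum_insert_b[OF i] algebra_simps)
    then show ?thesis using mass_pos[of t] by (simp add: var_def cond_def)
  qed
  ultimately have "mass t * ((?q - mean t i) * - cov t i) \<le> mass t * (mean t i * var t)"
    by (metis mult.assoc mult.commute)
  then show ?thesis using mass_pos[of t] by (simp only: mult_le_cancel_left_pos)
qed


end

section \<open>Evolution along the tilt\<close>

lemma deriv_within_nonneg_imp_le:
  fixes F :: "real \<Rightarrow> real"
  assumes "a \<le> c"
    and deriv: "\<And>t. t \<in> {a..c} \<Longrightarrow> (F has_real_derivative F' t) (at t within {a..c})"
    and nonneg: "\<And>t. t \<in> {a..c} \<Longrightarrow> F' t \<ge> 0"
  shows "F a \<le> F c"
proof (rule DERIV_nonneg_imp_increasing_open[OF \<open>a \<le> c\<close>])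
  fix t assume t: "a < t" "t < c"
  then show "\<exists>y. DERIV F t :> y \<and> y \<ge> 0"
    using deriv[of t] nonneg[of t] by (auto simp: at_within_Icc_at)
next
  show "continuous_on {a..c} F"
    using deriv by (rule DERIV_continuous_on)
qed

lemma prod_le_power_mean:
  fixes x :: "'a \<Rightarrow> real"
  assumes "finite S" "S \<noteq> {}" and x: "\<And>i. i \<in> S \<Longrightarrow> x i \<ge> 0"
  shows "(\<Prod>i\<in>S. x i) \<le> ((\<Sum>i\<in>S. x i) / card S) ^ card S"
proof -
  let ?n = "card S" and ?P = "\<Prod>i\<in>S. x i"
  have n: "?n > 0" using assms by (simp add: card_gt_0_iff)
  have P: "?P \<ge> 0" using x by (rule prod_nonneg)
  have "?P powr (1 / ?n) \<le> (\<Sum>i\<in>S. x i) / ?n"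
    using arith_geom_mean[OF assms] by (simp add: sum_divide_distrib)
  then have "(?P powr (1 / ?n)) ^ ?n \<le> ((\<Sum>i\<in>S. x i) / ?n) ^ ?n"
    by (rule power_mono) simp
  moreover have "(?P powr (1 / ?n)) ^ ?n = ?P"
  proof (cases "?P = 0")
    case True
    then show ?thesis using n by simp
  next
    case False
    then show ?thesis using P n by (simp add: powr_realpow[symmetric] powr_powr)
  qed
  ultimately show ?thesis by simp
qed

section \<open>Derivatives in the tilt parameter and growth of the probability\<close>

context two_point_tilt
begin

lemma f_deriv: "((\<lambda>t. f t i) has_real_derivative - b i * f t i) (at t within S)"
  unfolding f_def by (auto intro!: derivative_eq_intros)

text \<open>\<open>mean t i * (b i - mean t i)\<close> is the variance of the \<open>i\<close>-th
  variable: tilting decreases a mean at the rate of the variance.\<close>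

lemma mean_deriv:
  assumes i: "i \<in> N"
  shows "((\<lambda>t. mean t i) has_real_derivative - (mean t i * (b i - mean t i))) (at t within S)"
  unfolding mean_def
  by (rule derivative_eq_intros f_deriv refl | use norm_pos[OF i, of t] in \<open>simp; fail\<close>)+
    (use norm_pos[OF i, of t] in \<open>simp add: divide_simps, simp add: algebra_simps\<close>)

lemma U_eq: "I \<subseteq> N \<Longrightarrow> U t I = (\<Prod>i\<in>I. s i) * exp (- (t * sum b I)) * (\<Prod>i\<in>N - I. 1 - s i)"
  unfolding U_def f_def using finite_N
  by (simp add: prod.distrib exp_sum[symmetric] finite_subset sum_negf sum_distrib_left)

lemma U_deriv:
  assumes "I \<subseteq> N"
  shows "((\<lambda>t. U t I) has_real_derivative - sum b I * U t I) (at t within S)"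
  unfolding U_eq[OF assms] by (auto intro!: derivative_eq_intros)

lemma sum_A_deriv:
  "((\<lambda>t. \<Sum>I\<in>A. U t I * h I) has_real_derivative - (\<Sum>I\<in>A. U t I * (sum b I * h I))) (at t within S)"
proof -
  have "((\<lambda>t. \<Sum>I\<in>A. U t I * h I) has_real_derivative (\<Sum>I\<in>A. - sum b I * U t I * h I)) (at t within S)"
    by (intro DERIV_sum DERIV_cmult_right U_deriv A_subset)
  then show ?thesis by (simp add: sum_negf mult_ac)
qed

lemma mass_deriv: "(mass has_real_derivative - (mass t * (T - slack t))) (at t within S)"
proof -
  have "mass t * (T - slack t) = (\<Sum>I\<in>A. U t I * sum b I)"
    unfolding cond_sum_b[symmetric] cond_def using mass_pos[of t] by simp
  then show ?thesis
    using sum_A_deriv[of "\<lambda>_. 1" t S] by (simp add: mass_def[abs_def])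
qed

text \<open>The conditioned law is itself an exponential tilt, so the conditional mean of the sum
  decreases at the rate of its conditional variance.\<close>

lemma slack_deriv: "(slack has_real_derivative var t) (at t within S)"
proof -
  have "(slack has_real_derivative
      ((- (\<Sum>I\<in>A. U t I * (sum b I * (T - sum b I)))) * mass t
        - (\<Sum>I\<in>A. U t I * (T - sum b I)) * (- (mass t * (T - slack t)))) / (mass t * mass t)) (at t within S)"
    unfolding slack_def[abs_def, unfolded cond_def]
    using mass_pos[of t]
    by (intro DERIV_divide sum_A_deriv mass_deriv[unfolded slack_def cond_def]) auto
  moreover have "((- (\<Sum>I\<in>A. U t I * (sum b I * (T - sum b I)))) * mass t
        - (\<Sum>I\<in>A. U t I * (T - sum b I)) * (- (mass t * (T - slack t)))) / (mass t * mass t)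
      = slack t * (T - slack t) - cond t (\<lambda>I. sum b I * (T - sum b I))"
  proof -
    have "(\<Sum>I\<in>A. U t I * (T - sum b I)) = mass t * slack t"
         "(\<Sum>I\<in>A. U t I * (sum b I * (T - sum b I))) = mass t * cond t (\<lambda>I. sum b I * (T - sum b I))"
      unfolding slack_def cond_def using mass_pos[of t] by auto
    then show ?thesis using mass_pos[of t] by (simp only:) (simp add: field_simps)
  qed
  moreover have "var t = slack t * (T - slack t) - cond t (\<lambda>I. sum b I * (T - sum b I))"
    unfolding var_eq right_diff_distrib[of "sum b _"] cond_diff
    by (simp add: cond_cmult[of t "slack t", symmetric] mult.commute[of _ "slack t"] cond_sum_b[symmetric])
  ultimately show ?thesis by simp
qed

lemma slack_mono:
  assumes "t \<le> u"
  shows "slack t \<le> slack u"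
  using assms slack_deriv var_nonneg by (rule deriv_within_nonneg_imp_le)

text \<open>Serves the continuity of \<open>gap\<close>, on which the integral in \<open>E\<close>
  rests.\<close>

lemma gap_deriv_exists: "i \<in> N \<Longrightarrow> \<exists>d. ((\<lambda>t. gap t i) has_real_derivative d) (at t)"
proof -
  assume i: "i \<in> N"
  have "((\<lambda>t. (\<Sum>I\<in>A. U t I * X i I) / mass t) has_real_derivative
      (- (\<Sum>I\<in>A. U t I * (sum b I * X i I)) * mass t - (\<Sum>I\<in>A. U t I * X i I) * - (mass t * (T - slack t)))
        / (mass t * mass t)) (at t)"
    using mass_pos[of t] by (intro DERIV_divide sum_A_deriv mass_deriv) auto
  from DERIV_diff[OF mean_deriv[OF i] this] show ?thesis
    unfolding gap_def cond_def by blast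
qed

lemma gap_continuous: "i \<in> N \<Longrightarrow> continuous_on S (\<lambda>t. gap t i)"
  using gap_deriv_exists[of i] by (meson DERIV_isCont continuous_at_imp_continuous_on)

text \<open>For \<open>t \<ge> 0\<close> this solves \<open>E' = gap * E\<close> with initial value
  1, which makes it an integrating factor later on.\<close>

definition E :: "'i \<Rightarrow> real \<Rightarrow> real" where
  "E i t = exp (integral {0..t} (\<lambda>u. gap u i))"

lemma E_0: "E i 0 = 1"
  by (simp add: E_def)

lemma E_ge_1: "i \<in> N \<Longrightarrow> E i t \<ge> 1"
  unfolding E_def
  by (simp add: integral_nonneg[OF integrable_continuous_real[OF gap_continuous]] gap_nonneg)

lemma E_deriv:
  assumes "i \<in> N" "t \<in> {0..c}"
  shows "(E i has_real_derivative gap t i * E i t) (at t within {0..c})"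
  unfolding E_def[abs_def]
  by (rule derivative_eq_intros integral_has_real_derivative[OF gap_continuous] refl assms)+ simp

lemma below_pos: "below t > 0"
  unfolding below_def using mass_pos[of t] by (auto intro!: divide_pos_pos prod_pos norm_pos)

lemma ln_below: "ln (below t) = ln (mass t) - (\<Sum>i\<in>N. ln (f t i + (1 - s i)))"
proof -
  have "ln (below t) = ln (mass t) - ln (\<Prod>i\<in>N. f t i + (1 - s i))"
    unfolding below_def by (intro ln_divide_pos mass_pos prod_pos norm_pos)
  also have "ln (\<Prod>i\<in>N. f t i + (1 - s i)) = (\<Sum>i\<in>N. ln (f t i + (1 - s i)))"
    by (rule ln_prod[OF finite_N]) (metis norm_pos less_irrefl)
  finally show ?thesis .
qed

text \<open>The logarithmic derivative of \<open>mass\<close> is minus the sum of the conditional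
  means, that of the normalising product minus the sum of the means; the difference is the sum of
  the gaps.\<close>

lemma below_eq:
  assumes "t \<ge> 0"
  shows "below t = below 0 * (\<Prod>i\<in>N. E i t)"
proof -
  let ?D = "\<lambda>u. ln (mass u) - (\<Sum>i\<in>N. ln (f u i + (1 - s i))) - (\<Sum>i\<in>N. integral {0..u} (\<lambda>v. gap v i))"
  have deriv: "(?D has_real_derivative 0) (at u within {0..t})" if u: "u \<in> {0..t}" for u
  proof -
    have "(?D has_real_derivative
        1 / mass u * - (mass u * (T - slack u))
        - (\<Sum>i\<in>N. 1 / (f u i + (1 - s i)) * (- b i * f u i + 0))
        - (\<Sum>i\<in>N. gap u i)) (at u within {0..t})"
      by (intro DERIV_diff DERIV_sum DERIV_add DERIV_const f_deriv mass_deriv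
          DERIV_chain2[OF DERIV_ln_divide] integral_has_real_derivative gap_continuous u mass_pos norm_pos)
    moreover have "1 / mass u * - (mass u * (T - slack u))
        - (\<Sum>i\<in>N. 1 / (f u i + (1 - s i)) * (- b i * f u i + 0))
        - (\<Sum>i\<in>N. gap u i) = 0"
    proof -
      have "(\<Sum>i\<in>N. 1 / (f u i + (1 - s i)) * (- b i * f u i + 0)) = - (\<Sum>i\<in>N. mean u i)"
        by (simp add: mean_def sum_negf)
      then show ?thesis
        using mass_pos[of u] by (simp add: gap_def sum_subtractf sum_cond_X)
    qed
    ultimately show ?thesis by simp
  qed
  have "?D 0 \<le> ?D t"
    by (rule deriv_within_nonneg_imp_le[OF assms deriv]) simp_all
  \<comment> \<open>Monotonicity of both \<open>?D\<close> and \<open>- ?D\<close> gives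
    constancy.\<close>
  moreover have "- ?D 0 \<le> - ?D t"
  proof (rule deriv_within_nonneg_imp_le[OF assms, where F' = "\<lambda>_. 0"])
    show "((\<lambda>u. - ?D u) has_real_derivative 0) (at u within {0..t})" if "u \<in> {0..t}" for u
      using DERIV_minus[OF deriv[OF that]] by simp
  qed simp
  ultimately have "ln (below t) = ln (below 0) + (\<Sum>i\<in>N. integral {0..t} (\<lambda>v. gap v i))"
    unfolding ln_below by simp
  then have "exp (ln (below t)) = exp (ln (below 0) + (\<Sum>i\<in>N. integral {0..t} (\<lambda>v. gap v i)))"
    by simp
  then show ?thesis
    using below_pos by (simp add: exp_add exp_sum finite_N E_def)
qed

text \<open>Under the normalised tilted law the left side is the mean of \<open>T - S\<close>, the
  right side that of its positive part.\<close>

lemma below_slack_ge: "T - (\<Sum>i\<in>N. mean t i) \<le> below t * slack t"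
proof -
  let ?D = "\<Prod>i\<in>N. f t i + (1 - s i)"
  have D: "?D > 0" by (auto intro!: prod_pos norm_pos)
  have tot: "(\<Sum>I\<in>Pow N. U t I) = ?D"
    unfolding U_def by (rule prod_add[OF finite_N, symmetric])
  have X: "(\<Sum>I\<in>Pow N. U t I * X i I) = ?D * mean t i" if i: "i \<in> N" for i
  proof -
    have "?D = (\<Sum>J\<in>Pow (N - {i}). R t i J) * (f t i + (1 - s i))"
      using sum_Pow_split[OF i, of t "\<lambda>_. 1"] unfolding tot[symmetric]
      by (simp add: sum_distrib_right add.commute)
    moreover have "(\<Sum>I\<in>Pow N. U t I * X i I) = (\<Sum>J\<in>Pow (N - {i}). R t i J) * (b i * f t i)"
      unfolding sum_Pow_split[OF i] sum_distrib_right
      by (rule sum.cong) (auto simp: X_def)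
    ultimately show ?thesis
      using norm_pos[OF i, of t] by (simp add: mean_def)
  qed
  have "(\<Sum>I\<in>Pow N. U t I * sum b I) = (\<Sum>I\<in>Pow N. \<Sum>i\<in>N. U t I * X i I)"
    by (rule sum.cong) (auto simp: sum_distrib_left[symmetric] sum_X)
  also have "\<dots> = (\<Sum>i\<in>N. \<Sum>I\<in>Pow N. U t I * X i I)"
    by (rule sum.swap)
  also have "\<dots> = ?D * (\<Sum>i\<in>N. mean t i)"
    by (simp add: X sum_distrib_left)
  finally have "?D * (T - (\<Sum>i\<in>N. mean t i)) = (\<Sum>I\<in>Pow N. U t I * (T - sum b I))"
    by (simp add: right_diff_distrib sum_subtractf sum_distrib_right[symmetric] tot)
  also have "\<dots> \<le> (\<Sum>I\<in>Pow N. if sum b I < T then U t I * (T - sum b I) else 0)"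
    by (rule sum_mono) (auto intro!: mult_nonneg_nonpos U_nonneg)
  also have "\<dots> = (\<Sum>I\<in>A. U t I * (T - sum b I))"
    unfolding A_def using finite_N by (subst sum.inter_filter) auto
  also have "\<dots> = mass t * slack t"
    unfolding slack_def cond_def using mass_pos[of t] by simp
  finally show ?thesis
    using D by (simp add: below_def field_simps)
qed

text \<open>The tilted law concentrates on the outcome where all variables vanish;
  \<open>?l t\<close> is the probability of that outcome.\<close>

lemma below_tendsto: "\<exists>l. (l \<longlongrightarrow> 1) at_top \<and> (\<forall>t. l t \<le> below t)"
proof (intro exI conjI allI)
  let ?l = "\<lambda>t. (\<Prod>i\<in>N. (1 - s i) / (f t i + (1 - s i)))"
  have "((\<lambda>t. f t i) \<longlongrightarrow> 0) at_top" if "i \<in> N" for i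
    unfolding f_def using b_pos[OF that] by real_asymp
  then have "(?l \<longlongrightarrow> (\<Prod>i\<in>N. (1 - s i) / (0 + (1 - s i)))) at_top"
    by (intro tendsto_prod tendsto_divide tendsto_add tendsto_const) (auto dest: s_less)
  moreover have "(\<Prod>i\<in>N. (1 - s i) / (0 + (1 - s i))) = 1"
    by (rule prod.neutral) (auto dest: s_less)
  ultimately show "(?l \<longlongrightarrow> 1) at_top" by simp
  fix t
  have "U t {} \<le> mass t"
    unfolding mass_def
    by (rule member_le_sum[OF empty_in_A]) (auto simp: finite_A intro: U_nonneg dest: A_subset)
  then have "U t {} / (\<Prod>i\<in>N. f t i + (1 - s i)) \<le> below t"
    unfolding below_def by (intro divide_right_mono prod_nonneg) (auto intro: less_imp_le norm_pos)
  then show "?l t \<le> below t"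
    by (simp add: U_def prod_dividef)
qed

lemma mean_le:
  assumes i: "i \<in> N" and "t \<ge> 0"
  shows "mean t i \<le> s i * b i"
proof -
  have "f t i \<le> s i"
    unfolding f_def using assms b_pos[OF i] s_nonneg[OF i] by (simp add: mult_left_le)
  then have "f t i * (1 - s i) \<le> s i * (1 - s i)"
    using s_less[OF i] by (intro mult_right_mono) auto
  then have "f t i \<le> s i * (f t i + (1 - s i))"
    by (simp add: algebra_simps)
  then have "b i * f t i \<le> b i * (s i * (f t i + (1 - s i)))"
    using b_pos[OF i] by (intro mult_left_mono) auto
  then show ?thesis
    using norm_pos[OF i, of t] by (simp add: mean_def field_simps)
qed

lemma mean_0: "i \<in> N \<Longrightarrow> mean 0 i = s i * b i"
  by (simp add: mean_def f_def)

end

section \<open>The drop of the means and the bound for two-point variables\<close>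

context two_point_tilt
begin

lemma below_0_eq: "below 0 = (\<Sum>I\<in>A. (\<Prod>i\<in>I. s i) * (\<Prod>i\<in>N - I. 1 - s i))"
  by (simp add: below_def mass_def U_def f_def)

text \<open>The means drop fast enough that \<open>below c \<ge> \<delta>\<close> follows once the
  total excess of the \<open>E i c\<close> over 1 equals \<open>\<delta>\<close>.\<close>

lemma sum_E_excess_le_imp:
  fixes \<delta> :: real
  assumes \<delta>: "0 < \<delta>" "\<delta> \<le> 1" and T: "T = \<delta> + (\<Sum>i\<in>N. s i * b i)"
    and mean_le_1: "\<And>i. i \<in> N \<Longrightarrow> s i * b i \<le> 1"
    and slack: "slack 0 \<ge> 1 + \<delta>"
    and c: "c \<ge> 0" "(\<Sum>i\<in>N. E i c - 1) \<le> \<delta>"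
  shows "(slack c - 1) * (\<Sum>i\<in>N. E i c - 1) \<le> (\<Sum>i\<in>N. s i * b i - mean c i)"
proof -
  \<comment> \<open>\<open>covariance_lower_bound\<close> with
    \<open>slack t - mean t i \<ge> \<delta>\<close> and \<open>mean t i \<le> 1\<close> bounds
    \<open>- cov t i\<close> by \<open>var t / \<delta>\<close>.\<close>
  define K where "K = 1 / \<delta>"
  have K: "K \<ge> 1" using \<delta> by (simp add: K_def)
  \<comment> \<open>The sum of the \<open>H i\<close> is to be shown nonnegative. Each single one can be negative, because
    \<open>cov t i\<close> can, but not below \<open>- K * E i t * (slack t - slack 0)\<close>; the growth of \<open>slack\<close>
    makes up for this in the sum.\<close>
  define H where "H i t = s i * b i - mean t i - (slack t - 1) * (E i t - 1)" for i t
  define H' where "H' i t = mean t i * (b i - mean t i)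
      - (var t * (E i t - 1) + (slack t - 1) * (gap t i * E i t))" for i t
  have E_pos: "E i t > 0" for i t by (simp add: E_def)
  have H_deriv: "(H i has_real_derivative H' i t) (at t within {0..c})"
    if "i \<in> N" "t \<in> {0..c}" for i t
    unfolding H_def[abs_def] H'_def
    by (rule derivative_eq_intros mean_deriv slack_deriv E_deriv refl that)+ (simp add: algebra_simps)
  have H_0: "H i 0 = 0" if "i \<in> N" for i
    using that by (simp add: H_def mean_0 E_0)
  have slack_ge: "slack t \<ge> 1 + \<delta>" if "t \<ge> 0" for t
    using slack slack_mono[OF that] by linarith
  have mean_1: "mean t i \<le> 1" if "i \<in> N" "t \<ge> 0" for i t
    using mean_le[OF that] mean_le_1[OF that(1)] by linarith
  have cov: "cov t i \<ge> - K * var t" if i: "i \<in> N" and t: "t \<ge> 0" for i t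
  proof (cases "cov t i \<ge> 0")
    case True
    then show ?thesis using K var_nonneg[of t]
      by (smt (verit) mult_nonneg_nonneg mult_minus_left)
  next
    case False
    have "\<delta> * - cov t i \<le> (slack t - mean t i) * - cov t i"
      using False slack_ge[OF t] mean_1[OF i t] by (intro mult_right_mono) auto
    also have "\<dots> \<le> mean t i * var t"
      using slack_ge[OF t] mean_1[OF i t] \<delta> by (intro covariance_lower_bound i) auto
    also have "\<dots> \<le> 1 * var t"
      using mean_1[OF i t] var_nonneg by (intro mult_right_mono) auto
    finally show ?thesis using \<delta> by (simp add: K_def field_simps)
  qed
  \<comment> \<open>With the variance replaced by its lower bound, the two sides differ by exactly
    \<open>gap t i * (1 - s i * b i)\<close>.\<close>
  have H'_ge: "H' i t \<ge> gap t i * H i t + cov t i - var t * (E i t - 1)"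
    if i: "i \<in> N" and t: "t \<ge> 0" for i t
  proof -
    have "gap t i * (s i * b i) \<le> gap t i * 1"
      using gap_nonneg[OF i] mean_le_1[OF i] by (intro mult_left_mono) auto
    then show ?thesis
      using variance_lower_bound[OF i, of t] unfolding H'_def H_def
      by (simp add: algebra_simps)
  qed
  have H_ge: "H i t \<ge> - K * E i t * (slack t - slack 0)"
    if i: "i \<in> N" and t: "t \<in> {0..c}" for i t
  proof -
    \<comment> \<open>Dividing by \<open>E i\<close> removes the term \<open>gap * H\<close> from
      \<open>H'_ge\<close>; what remains is at least \<open>- K * var\<close>, and
      \<open>K * slack\<close> has derivative \<open>K * var\<close>.\<close>
    let ?F = "\<lambda>u. H i u / E i u + K * slack u"
    let ?F' = "\<lambda>u. (H' i u * E i u - H i u * (gap u i * E i u)) / (E i u * E i u) + K * var u"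
    have "?F 0 \<le> ?F t"
    proof (rule deriv_within_nonneg_imp_le[where F = ?F and a = 0 and c = t and F' = ?F'])
      show "0 \<le> t" using t by simp
      fix u assume u: "u \<in> {0..t}"
      then have u': "u \<in> {0..c}" "u \<ge> 0" using t by auto
      have "(?F has_real_derivative ?F' u) (at u within {0..c})"
        using E_pos[of i u]
        by (intro DERIV_add DERIV_divide DERIV_cmult H_deriv E_deriv slack_deriv i u') auto
      then show "(?F has_real_derivative ?F' u) (at u within {0..t})"
        by (rule DERIV_subset) (use t in auto)
      have "(H' i u * E i u - H i u * (gap u i * E i u)) / (E i u * E i u) = (H' i u - gap u i * H i u) / E i u"
        using E_pos[of i u] by (simp add: field_simps)
      moreover have "- K * var u * E i u \<le> H' i u - gap u i * H i u"
      proof -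
        have "0 \<le> (K - 1) * var u * (E i u - 1)"
          using K var_nonneg[of u] E_ge_1[OF i, of u] by (intro mult_nonneg_nonneg) auto
        then show ?thesis
          using H'_ge[OF i u'(2)] cov[OF i u'(2)] by (simp add: algebra_simps)
      qed
      then have "- K * var u \<le> (H' i u - gap u i * H i u) / E i u"
        using E_pos[of i u] by (simp add: field_simps)
      ultimately show "0 \<le> ?F' u"
        by simp
    qed
    then have "- K * (slack t - slack 0) \<le> H i t / E i t"
      using H_0[OF i] by (simp add: algebra_simps)
    then show ?thesis
      using E_pos[of i t] by (simp add: field_simps)
  qed
  define e where "e t = (\<Sum>i\<in>N. E i t - 1)" for t
  \<comment> \<open>The factor \<open>1 - K * e t\<close> is chosen so that its derivative cancels
    the loss from \<open>H_ge\<close>, while \<open>sum_cov\<close> supplies the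
    \<open>var t\<close> that pays for the growth of \<open>slack\<close>. It is still nonnegative
    at \<open>c\<close> because \<open>e c \<le> \<delta> = 1 / K\<close>.\<close>
  define G where "G t = (\<Sum>i\<in>N. H i t) - (slack t - slack 0) * (1 - K * e t)" for t
  let ?G' = "\<lambda>t. (\<Sum>i\<in>N. H' i t)
        - (var t * (1 - K * e t) + (slack t - slack 0) * (0 - K * (\<Sum>i\<in>N. gap t i * E i t - 0)))"
  have "G 0 \<le> G c"
  proof (rule deriv_within_nonneg_imp_le[where F = G and a = 0 and c = c and F' = ?G'])
    show "0 \<le> c" by (rule c(1))
    fix t assume t: "t \<in> {0..c}"
    show "(G has_real_derivative ?G' t) (at t within {0..c})"
      unfolding G_def[abs_def] e_def
      by (rule derivative_eq_intros H_deriv E_deriv slack_deriv t refl | assumption)+ (simp add: algebra_simps)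
    have "(\<Sum>i\<in>N. H' i t) \<ge> (\<Sum>i\<in>N. gap t i * (- K * E i t * (slack t - slack 0)) + cov t i - var t * (E i t - 1))"
    proof (rule sum_mono)
      fix i assume i: "i \<in> N"
      have "gap t i * (- K * E i t * (slack t - slack 0)) \<le> gap t i * H i t"
        by (intro mult_left_mono H_ge gap_nonneg i t)
      then show "gap t i * (- K * E i t * (slack t - slack 0)) + cov t i - var t * (E i t - 1) \<le> H' i t"
        using H'_ge[OF i, of t] t by auto
    qed
    also have "(\<Sum>i\<in>N. gap t i * (- K * E i t * (slack t - slack 0)) + cov t i - var t * (E i t - 1))
        = - K * (slack t - slack 0) * (\<Sum>i\<in>N. gap t i * E i t) + var t - var t * e t"
      unfolding e_def
      by (simp add: sum.distrib sum_subtractf sum_cov sum_distrib_left right_diff_distrib mult_ac)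
    finally have "- K * (slack t - slack 0) * (\<Sum>i\<in>N. gap t i * E i t) + var t - var t * e t \<le> (\<Sum>i\<in>N. H' i t)" .
    moreover have "0 \<le> (K - 1) * var t * e t"
      using K var_nonneg[of t] E_ge_1 by (intro mult_nonneg_nonneg) (auto simp: e_def intro!: sum_nonneg)
    ultimately show "0 \<le> ?G' t"
      by (simp add: algebra_simps)
  qed
  moreover have "G 0 = 0"
    by (simp add: G_def H_0)
  moreover have "0 \<le> (slack c - slack 0) * (1 - K * e c)"
    using slack_mono[OF c(1)] c(2) \<delta>
    by (intro mult_nonneg_nonneg) (auto simp: e_def K_def field_simps)
  ultimately have "0 \<le> (\<Sum>i\<in>N. H i c)"
    by (simp add: G_def)
  then show ?thesis
    unfolding H_def by (simp only: sum_subtractf flip: sum_distrib_left)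
qed

theorem below_0_ge:
  fixes \<delta> :: real
  assumes \<delta>: "0 < \<delta>" "\<delta> \<le> 1" and T: "T = \<delta> + (\<Sum>i\<in>N. s i * b i)"
    and mean_le_1: "\<And>i. i \<in> N \<Longrightarrow> s i * b i \<le> 1"
    and N: "N \<noteq> {}"
  shows "\<delta> / (1 + \<delta> / card N) ^ card N \<le> below 0"
proof -
  let ?n = "card N"
  let ?P = "(1 + \<delta> / ?n) ^ ?n"
  have n: "?n > 0" using N finite_N by (simp add: card_gt_0_iff)
  have P: "?P > 0" using \<delta> by (auto intro!: zero_less_power add_pos_nonneg)
  \<comment> \<open>Bernoulli makes \<open>below 0 \<ge> \<delta> / slack 0\<close> sufficient when
    \<open>slack 0 < 1 + \<delta>\<close>.\<close>
  have "1 + real ?n * (\<delta> / ?n) \<le> ?P"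
    using \<delta> n by (intro Bernoulli_inequality) (auto intro: order_trans[of _ 0])
  then have bern: "1 + \<delta> \<le> ?P" using n by simp
  have slack_0: "\<delta> \<le> below 0 * slack 0"
    using below_slack_ge[of 0] by (simp add: T mean_0)
  then have slack_0_pos: "slack 0 > 0"
    using \<delta> below_pos[of 0] by (metis less_le_trans zero_less_mult_pos)
  show ?thesis
  proof (cases "slack 0 < 1 + \<delta>")
    case True
    have "\<delta> \<le> below 0 * slack 0" by (rule slack_0)
    also have "\<dots> \<le> below 0 * ?P"
      using True bern below_pos[of 0] by (intro mult_left_mono) auto
    finally show ?thesis using P by (simp add: field_simps)
  next
    case False
    define e where "e t = (\<Sum>i\<in>N. E i t - 1)" for t
    have bound: "below t \<le> below 0 * ?P" if "t \<ge> 0" "e t \<le> \<delta>" for t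
    proof -
      have "(\<Prod>i\<in>N. E i t) \<le> ((\<Sum>i\<in>N. E i t) / ?n) ^ ?n"
        by (intro prod_le_power_mean finite_N N) (simp add: E_def)
      also have "\<dots> \<le> ?P"
        using that(2) n
        by (intro power_mono divide_nonneg_nonneg sum_nonneg)
          (auto simp: e_def E_def sum_subtractf field_simps)
      finally have "below 0 * (\<Prod>i\<in>N. E i t) \<le> below 0 * ?P"
        using below_pos[of 0] by (intro mult_left_mono) auto
      then show ?thesis using below_eq[OF that(1)] by simp
    qed
    show ?thesis
    proof (cases "\<exists>t\<ge>0. e t = \<delta>")
      case True
      then obtain t where t: "t \<ge> 0" "e t = \<delta>" by blast
      have "(slack t - 1) * \<delta> \<le> (\<Sum>i\<in>N. s i * b i - mean t i)"
        using sum_E_excess_le_imp[OF \<delta> T mean_le_1 _ t(1)] False t(2) by (simp add: e_def)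
      then have "\<delta> * slack t \<le> T - (\<Sum>i\<in>N. mean t i)"
        by (simp add: T sum_subtractf algebra_simps)
      also have "\<dots> \<le> below t * slack t" by (rule below_slack_ge)
      finally have "\<delta> \<le> below t"
        using slack_0_pos slack_mono[OF t(1)] by simp
      then have "\<delta> \<le> below 0 * ?P" using bound[OF t(1)] t(2) by simp
      then show ?thesis using P by (simp add: field_simps)
    next
      \<comment> \<open>By continuity the excess then stays below \<open>\<delta>\<close>, so
        \<open>bound\<close> holds for all \<open>t \<ge> 0\<close> and the limit 1 of the lower
        bound \<open>l\<close> passes to \<open>below 0 * ?P\<close>.\<close>
      case no: False
      have less: "e t < \<delta>" if t: "t \<ge> 0" for t
      proof (rule ccontr)
        assume "\<not> e t < \<delta>"
        moreover have "e 0 \<le> \<delta>" using \<delta> by (simp add: e_def E_0)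
        moreover have "continuous_on {0..t} e"
          unfolding e_def
          by (intro continuous_intros DERIV_continuous_on[OF E_deriv])
        ultimately have "\<exists>x\<ge>0. x \<le> t \<and> e x = \<delta>"
          using t by (intro IVT') auto
        then show False using no by blast
      qed
      obtain l where l: "(l \<longlongrightarrow> 1) at_top" "\<And>t. l t \<le> below t"
        using below_tendsto by blast
      have "eventually (\<lambda>t. l t \<le> below 0 * ?P) at_top"
        using eventually_ge_at_top[of "0 :: real"]
      proof eventually_elim
        case (elim t)
        then show ?case using bound[of t] less[of t] l(2)[of t] by simp
      qed
      then have "1 \<le> below 0 * ?P"
        by (rule tendsto_upperbound[OF l(1)]) simp
      then have "\<delta> \<le> below 0 * ?P" using \<delta> by simp
      then show ?thesis using P by (simp add: field_simps)
    qed
  qed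
qed

end

section \<open>Reduction to two-point laws\<close>

text \<open>A separation argument: a supporting line takes the place of an explicit decomposition of
  the law of \<open>Y\<close> into two-point laws of mean 1.\<close>

lemma (in prob_space) two_point_minorant:
  fixes Y :: "'a \<Rightarrow> real" and \<psi> :: "real \<Rightarrow> real"
  assumes nonneg: "AE \<omega> in M. 0 \<le> Y \<omega>" and int: "integrable M Y" and mean: "expectation Y = 1"
    and \<psi>: "\<psi> \<in> borel_measurable borel" "\<And>x. \<bar>\<psi> x\<bar> \<le> C"
  shows "\<exists>a b s. 0 \<le> a \<and> 0 < b \<and> 0 \<le> s \<and> s < 1 \<and> a + s * b = 1
      \<and> (1 - s) * \<psi> a + s * \<psi> (a + b) \<le> expectation (\<lambda>\<omega>. \<psi> (Y \<omega>))"
proof (rule ccontr)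
  assume no: "\<not> ?thesis"
  have Y[measurable]: "Y \<in> borel_measurable M" using int by simp
  note \<psi>(1)[measurable]
  have \<psi>_int: "integrable M (\<lambda>\<omega>. \<psi> (Y \<omega>))"
    by (rule integrable_const_bound[where B = C]) (auto simp: \<psi>(2))
  define v where "v = expectation (\<lambda>\<omega>. \<psi> (Y \<omega>))"
  define \<phi> where "\<phi> x = \<psi> x - v" for x
  \<comment> \<open>The point mass at 1 is covered as the degenerate case \<open>a = 1\<close>,
    \<open>b = 1\<close>, \<open>s = 0\<close>.\<close>
  have at_1: "\<phi> 1 > 0"
  proof (rule ccontr)
    assume "\<not> \<phi> 1 > 0"
    then have "(1 - 0) * \<psi> 1 + 0 * \<psi> (1 + 1) \<le> v" by (simp add: \<phi>_def)
    then show False using no unfolding v_def by (metis add_0_right less_eq_real_def mult_zero_left zero_less_one)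
  qed
  have pair: "(y - 1) * \<phi> x + (1 - x) * \<phi> y > 0" if "0 \<le> x" "x < 1" "1 < y" for x y
  proof (rule ccontr)
    define s where "s = (1 - x) / (y - x)"
    assume "\<not> (y - 1) * \<phi> x + (1 - x) * \<phi> y > 0"
    then have "((y - 1) * \<psi> x + (1 - x) * \<psi> y) / (y - x) \<le> v"
      using that by (simp add: \<phi>_def pos_divide_le_eq algebra_simps)
    moreover have "((y - 1) * \<psi> x + (1 - x) * \<psi> y) / (y - x) = (1 - s) * \<psi> x + s * \<psi> (x + (y - x))"
    proof -
      have "1 - s = (y - 1) / (y - x)" using that by (simp add: s_def field_simps)
      then show ?thesis by (simp add: s_def add_divide_distrib)
    qed
    moreover have "0 \<le> s" "s < 1" "x + s * (y - x) = 1" "0 < y - x"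
      using that by (auto simp: s_def field_simps)
    ultimately show False using no that unfolding v_def by metis
  qed
  \<comment> \<open>\<open>\<Lambda>\<close> is the slope of a line through \<open>(1, 0)\<close> below \<open>\<phi>\<close>; since \<open>\<phi> \<circ> Y\<close> has mean \<open>0\<close>, \<open>\<phi>\<close> meets
    the line almost surely, on both sides of \<open>1\<close>, which contradicts \<open>pair\<close>.\<close>
  define \<Lambda> where "\<Lambda> = (SUP x\<in>{0..<1}. - \<phi> x / (1 - x))"
  \<comment> \<open>This is \<open>pair\<close> in terms of slopes; any \<open>y > 1\<close> bounds
    the supremum \<open>\<Lambda>\<close>.\<close>
  have slope: "- \<phi> x / (1 - x) \<le> \<phi> y / (y - 1)" if "x \<in> {0..<1}" "1 < y" for x y
    using pair[of x y] that by (simp add: field_simps)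
  have bdd: "bdd_above ((\<lambda>x. - \<phi> x / (1 - x)) ` {0..<1})"
    using slope[of _ 2] by (intro bdd_aboveI2) auto
  have line: "\<phi> z + \<Lambda> * (1 - z) \<ge> 0" if "z \<ge> 0" for z
  proof -
    consider "z < 1" | "z = 1" | "z > 1" by linarith
    then show ?thesis
    proof cases
      case 1
      then have "- \<phi> z / (1 - z) \<le> \<Lambda>"
        unfolding \<Lambda>_def using that by (intro cSUP_upper bdd) auto
      then show ?thesis using 1 by (simp add: field_simps)
    next
      case 2
      then show ?thesis using at_1 by simp
    next
      case 3
      then have "\<Lambda> \<le> \<phi> z / (z - 1)"
        unfolding \<Lambda>_def by (intro cSUP_least slope) auto
      then show ?thesis using 3 by (simp add: field_simps)
    qed
  qed
  have "expectation (\<lambda>\<omega>. \<phi> (Y \<omega>) + \<Lambda> * (1 - Y \<omega>)) = 0"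
    using int \<psi>_int mean by (simp add: \<phi>_def v_def[symmetric] prob_space)
  moreover have "integrable M (\<lambda>\<omega>. \<phi> (Y \<omega>) + \<Lambda> * (1 - Y \<omega>))"
    using int \<psi>_int by (simp add: \<phi>_def)
  moreover have "AE \<omega> in M. 0 \<le> \<phi> (Y \<omega>) + \<Lambda> * (1 - Y \<omega>)"
    using nonneg by eventually_elim (rule line)
  ultimately have eq: "AE \<omega> in M. \<phi> (Y \<omega>) + \<Lambda> * (1 - Y \<omega>) = 0"
    using integral_nonneg_eq_0_iff_AE by blast
  have ex: "\<exists>\<omega>. P \<omega> \<and> 0 \<le> Y \<omega> \<and> \<phi> (Y \<omega>) + \<Lambda> * (1 - Y \<omega>) = 0"
    if "\<not> (AE \<omega> in M. \<not> P \<omega>)" for P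
  proof (rule ccontr)
    assume none: "\<not> ?thesis"
    have "AE \<omega> in M. \<not> P \<omega>"
      using nonneg eq by eventually_elim (use none in blast)
    then show False using that by blast
  qed
  \<comment> \<open>A variable of mean 1 that stays on one side of 1 is almost surely 1; the sign of
    \<open>\<sigma>\<close> selects the side.\<close>
  have eq_1: "AE \<omega> in M. Y \<omega> = 1" if "AE \<omega> in M. 0 \<le> \<sigma> * (Y \<omega> - 1)" "\<sigma> \<noteq> 0" for \<sigma>
  proof -
    have "expectation (\<lambda>\<omega>. \<sigma> * (Y \<omega> - 1)) = 0"
      using int mean by (simp add: prob_space)
    then have "AE \<omega> in M. \<sigma> * (Y \<omega> - 1) = 0"
      using integral_nonneg_eq_0_iff_AE[of M "\<lambda>\<omega>. \<sigma> * (Y \<omega> - 1)"] that(1) int by simp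
    then show ?thesis by eventually_elim (use that(2) in simp)
  qed
  have not_1: "\<not> (AE \<omega> in M. Y \<omega> = 1)"
  proof
    assume *: "AE \<omega> in M. Y \<omega> = 1"
    have "\<not> (AE \<omega> in M. \<not> Y \<omega> = 1)"
    proof
      assume "AE \<omega> in M. \<not> Y \<omega> = 1"
      with * have "AE \<omega> in M. False" by eventually_elim simp
      then show False by simp
    qed
    from ex[OF this] show False using at_1 by auto
  qed
  have "\<not> (AE \<omega> in M. \<not> Y \<omega> < 1)"
    using eq_1[of 1] not_1 by (auto simp: not_less)
  from ex[OF this] obtain x where x: "x < 1" "0 \<le> x" "\<phi> x + \<Lambda> * (1 - x) = 0" by blast
  have "\<not> (AE \<omega> in M. \<not> Y \<omega> > 1)"
    using eq_1[of "-1"] not_1 by (auto simp: not_less)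
  from ex[OF this] obtain y where y: "y > 1" "\<phi> y + \<Lambda> * (1 - y) = 0" by blast
  have "(y - 1) * \<phi> x + (1 - x) * \<phi> y
      = (y - 1) * (\<phi> x + \<Lambda> * (1 - x)) + (1 - x) * (\<phi> y + \<Lambda> * (1 - y))"
    by (simp add: algebra_simps)
  then show False
    using pair[OF x(2,1) y(1)] x(3) y(2) by simp
qed

section \<open>Replacing the variables one at a time\<close>

lemma sum_Pow_insert:
  assumes "finite N" "i \<notin> N"
  shows "(\<Sum>I\<in>Pow (insert i N). h I) = (\<Sum>I\<in>Pow N. h I + h (insert i I))"
proof -
  have inj: "inj_on (insert i) (Pow N)" using assms(2) by (auto simp: inj_on_def)
  have "(\<Sum>I\<in>Pow (insert i N). h I) = (\<Sum>I\<in>Pow N. h I) + (\<Sum>I\<in>insert i ` Pow N. h I)"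
    unfolding Pow_insert using assms by (intro sum.union_disjoint) auto
  then show ?thesis by (simp add: sum.reindex[OF inj] sum.distrib)
qed

text \<open>Fubini: by independence the joint law is the product of the marginals.\<close>

lemma (in prob_space) expectation_indep_add:
  fixes Y Z :: "'a \<Rightarrow> real" and \<Phi> :: "real \<Rightarrow> real"
  assumes indep: "indep_var borel Y borel Z"
    and \<Phi>[measurable]: "\<Phi> \<in> borel_measurable borel" and bound: "\<And>x. \<bar>\<Phi> x\<bar> \<le> C"
  shows "(\<lambda>x. expectation (\<lambda>\<omega>. \<Phi> (x + Z \<omega>))) \<in> borel_measurable borel"
    and "expectation (\<lambda>\<omega>. \<Phi> (Y \<omega> + Z \<omega>)) = expectation (\<lambda>\<omega>. expectation (\<lambda>\<omega>'. \<Phi> (Y \<omega> + Z \<omega>')))"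
proof -
  have Y[measurable]: "Y \<in> borel_measurable M" and Z[measurable]: "Z \<in> borel_measurable M"
    using indep_var_rv1[OF indep] indep_var_rv2[OF indep] by auto
  let ?P = "distr M borel Y" and ?Q = "distr M borel Z"
  interpret P: prob_space ?P by (rule prob_space_distr) simp
  interpret Q: prob_space ?Q by (rule prob_space_distr) simp
  interpret PQ: pair_prob_space ?P ?Q ..
  have inner: "expectation (\<lambda>\<omega>. \<Phi> (x + Z \<omega>)) = (\<integral>y. \<Phi> (x + y) \<partial>?Q)" for x
    by (subst integral_distr) auto
  show meas: "(\<lambda>x. expectation (\<lambda>\<omega>. \<Phi> (x + Z \<omega>))) \<in> borel_measurable borel"
    by measurable
  have joint: "?P \<Otimes>\<^sub>M ?Q = distr M (borel \<Otimes>\<^sub>M borel) (\<lambda>\<omega>. (Y \<omega>, Z \<omega>))"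
    using indep by (simp add: indep_var_distribution_eq)
  have "expectation (\<lambda>\<omega>. \<Phi> (Y \<omega> + Z \<omega>)) = (\<integral>p. \<Phi> (fst p + snd p) \<partial>(?P \<Otimes>\<^sub>M ?Q))"
    unfolding joint by (subst integral_distr) auto
  also have "\<dots> = (\<integral>x. (\<integral>y. \<Phi> (x + y) \<partial>?Q) \<partial>?P)"
  proof (rule PQ.integral_fst'[symmetric, where f = "\<lambda>p. \<Phi> (fst p + snd p)", simplified])
    show "integrable (?P \<Otimes>\<^sub>M ?Q) (\<lambda>p. \<Phi> (fst p + snd p))"
      by (rule PQ.integrable_const_bound[where B = C]) (auto simp: bound)
  qed
  also have "\<dots> = (\<integral>x. expectation (\<lambda>\<omega>. \<Phi> (x + Z \<omega>)) \<partial>?P)"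
    by (simp add: inner)
  also have "\<dots> = expectation (\<lambda>\<omega>. expectation (\<lambda>\<omega>'. \<Phi> (Y \<omega> + Z \<omega>')))"
    using meas by (subst integral_distr) auto
  finally show "expectation (\<lambda>\<omega>. \<Phi> (Y \<omega> + Z \<omega>)) = expectation (\<lambda>\<omega>. expectation (\<lambda>\<omega>'. \<Phi> (Y \<omega> + Z \<omega>')))" .
qed

text \<open>With the other variables integrated out, the expectation is that of a bounded function
  \<open>g\<close> of a single variable, to which \<open>two_point_minorant\<close> applies.\<close>

lemma (in prob_space) two_point_reduction:
  fixes X :: "'i \<Rightarrow> 'a \<Rightarrow> real" and \<Phi> :: "real \<Rightarrow> real"
  assumes "finite N" and "indep_vars (\<lambda>_. borel) X N"
    and "\<And>i. i \<in> N \<Longrightarrow> AE \<omega> in M. 0 \<le> X i \<omega>"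
    and "\<And>i. i \<in> N \<Longrightarrow> integrable M (X i)"
    and "\<And>i. i \<in> N \<Longrightarrow> expectation (X i) = 1"
    and "\<Phi> \<in> borel_measurable borel" and "\<And>x. \<bar>\<Phi> x\<bar> \<le> C"
  shows "\<exists>a b s. (\<forall>i\<in>N. 0 \<le> a i \<and> 0 < b i \<and> 0 \<le> s i \<and> s i < 1 \<and> a i + s i * b i = 1)
      \<and> (\<Sum>I\<in>Pow N. (\<Prod>i\<in>I. s i) * (\<Prod>i\<in>N - I. 1 - s i) * \<Phi> (sum a N + sum b I))
          \<le> expectation (\<lambda>\<omega>. \<Phi> (\<Sum>i\<in>N. X i \<omega>))"
  using assms
proof (induction N arbitrary: \<Phi> rule: finite_induct)
  case empty
  then show ?case by (simp add: prob_space)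
next
  case (insert i N)
  let ?S = "\<lambda>\<omega>. \<Sum>i\<in>N. X i \<omega>"
  note \<Phi>[measurable] = insert.prems(5)
  have indep: "indep_var borel (X i) borel ?S"
    by (rule indep_vars_sum) (use insert in auto)
  have S[measurable]: "?S \<in> borel_measurable M"
    using indep_var_rv2[OF indep] .
  define g where "g x = expectation (\<lambda>\<omega>. \<Phi> (x + ?S \<omega>))" for x
  have \<Phi>_int: "integrable M (\<lambda>\<omega>. \<Phi> (x + ?S \<omega>))" for x
    by (rule integrable_const_bound[where B = C]) (auto simp: insert.prems(6))
  have g_bound: "\<bar>g x\<bar> \<le> C" for x
  proof -
    have "\<bar>g x\<bar> \<le> expectation (\<lambda>\<omega>. \<bar>\<Phi> (x + ?S \<omega>)\<bar>)"
      unfolding g_def by (rule integral_abs_bound)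
    also have "\<dots> \<le> expectation (\<lambda>_. C)"
      using \<Phi>_int by (intro integral_mono) (auto simp: insert.prems(6))
    finally show ?thesis by (simp add: prob_space)
  qed
  have g_meas: "g \<in> borel_measurable borel"
    unfolding g_def[abs_def] by (rule expectation_indep_add(1)[OF indep insert.prems(5,6)])
  have "\<exists>\<alpha> \<beta> \<sigma>. 0 \<le> \<alpha> \<and> 0 < \<beta> \<and> 0 \<le> \<sigma> \<and> \<sigma> < 1 \<and> \<alpha> + \<sigma> * \<beta> = 1
      \<and> (1 - \<sigma>) * g \<alpha> + \<sigma> * g (\<alpha> + \<beta>) \<le> expectation (\<lambda>\<omega>. g (X i \<omega>))"
    by (rule two_point_minorant) (use insert.prems g_meas g_bound in auto)
  then obtain \<alpha> \<beta> \<sigma> where i: "0 \<le> \<alpha>" "0 < \<beta>" "0 \<le> \<sigma>" "\<sigma> < 1" "\<alpha> + \<sigma> * \<beta> = 1"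
    and le: "(1 - \<sigma>) * g \<alpha> + \<sigma> * g (\<alpha> + \<beta>) \<le> expectation (\<lambda>\<omega>. g (X i \<omega>))" by blast
  \<comment> \<open>The new two-point variable is averaged into the test function, so the induction
    has to range over all \<open>\<Phi>\<close>; a convex combination keeps the bound
    \<open>C\<close>.\<close>
  define \<Psi> where "\<Psi> y = (1 - \<sigma>) * \<Phi> (\<alpha> + y) + \<sigma> * \<Phi> (\<alpha> + \<beta> + y)" for y
  have \<Psi>_meas: "\<Psi> \<in> borel_measurable borel"
    unfolding \<Psi>_def[abs_def] by measurable
  have \<Psi>_bound: "\<bar>\<Psi> y\<bar> \<le> C" for y
  proof -
    have "\<bar>\<Psi> y\<bar> \<le> (1 - \<sigma>) * \<bar>\<Phi> (\<alpha> + y)\<bar> + \<sigma> * \<bar>\<Phi> (\<alpha> + \<beta> + y)\<bar>"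
      unfolding \<Psi>_def using i by (intro order_trans[OF abs_triangle_ineq]) (simp add: abs_mult)
    also have "\<dots> \<le> (1 - \<sigma>) * C + \<sigma> * C"
      using i by (intro add_mono mult_left_mono insert.prems(6)) auto
    finally show ?thesis by (simp add: algebra_simps)
  qed
  have "indep_vars (\<lambda>_. borel) X N"
    using insert.prems(1) by (rule indep_vars_subset) auto
  from insert.IH[OF this insert.prems(2-4)[OF insertI2] \<Psi>_meas \<Psi>_bound]
  obtain a b s where N: "\<forall>i\<in>N. 0 \<le> a i \<and> 0 < b i \<and> 0 \<le> s i \<and> s i < 1 \<and> a i + s i * b i = 1"
    and IH: "(\<Sum>I\<in>Pow N. (\<Prod>i\<in>I. s i) * (\<Prod>i\<in>N - I. 1 - s i) * \<Psi> (sum a N + sum b I))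
          \<le> expectation (\<lambda>\<omega>. \<Psi> (?S \<omega>))"
    by blast
  let ?a = "a(i := \<alpha>)" and ?b = "b(i := \<beta>)" and ?s = "s(i := \<sigma>)"
  have "(\<Sum>I\<in>Pow (insert i N). (\<Prod>j\<in>I. ?s j) * (\<Prod>j\<in>insert i N - I. 1 - ?s j)
          * \<Phi> (sum ?a (insert i N) + sum ?b I))
      = (\<Sum>I\<in>Pow N. (\<Prod>i\<in>I. s i) * (\<Prod>i\<in>N - I. 1 - s i) * \<Psi> (sum a N + sum b I))"
    unfolding sum_Pow_insert[OF insert.hyps]
  proof (rule sum.cong[OF refl])
    fix I assume I: "I \<in> Pow N"
    then have fin: "finite I" "i \<notin> I" "finite (N - I)" "i \<notin> N - I"
      using insert.hyps by (auto intro: finite_subset)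
    have D: "insert i N - I = insert i (N - I)" "insert i N - insert i I = N - I"
      using insert.hyps I by auto
    have P: "(\<Prod>j\<in>I. ?s j) = (\<Prod>j\<in>I. s j)" "(\<Prod>j\<in>N - I. 1 - ?s j) = (\<Prod>j\<in>N - I. 1 - s j)"
      "sum ?b I = sum b I" "sum ?a N = sum a N"
      using fin insert.hyps by (auto intro!: prod.cong sum.cong)
    have Q: "(\<Prod>j\<in>insert i (N - I). 1 - ?s j) = (1 - \<sigma>) * (\<Prod>j\<in>N - I. 1 - ?s j)"
      "(\<Prod>j\<in>insert i I. ?s j) = \<sigma> * (\<Prod>j\<in>I. ?s j)"
      "sum ?b (insert i I) = \<beta> + sum ?b I" "sum ?a (insert i N) = \<alpha> + sum ?a N"
      using fin insert.hyps by (simp_all del: fun_upd_apply add: fun_upd_same)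
    show "(\<Prod>j\<in>I. ?s j) * (\<Prod>j\<in>insert i N - I. 1 - ?s j) * \<Phi> (sum ?a (insert i N) + sum ?b I)
        + (\<Prod>j\<in>insert i I. ?s j) * (\<Prod>j\<in>insert i N - insert i I. 1 - ?s j)
          * \<Phi> (sum ?a (insert i N) + sum ?b (insert i I))
        = (\<Prod>i\<in>I. s i) * (\<Prod>i\<in>N - I. 1 - s i) * \<Psi> (sum a N + sum b I)"
      unfolding D Q P by (simp add: \<Psi>_def algebra_simps)
  qed
  also have "\<dots> \<le> expectation (\<lambda>\<omega>. \<Psi> (?S \<omega>))" by (rule IH)
  also have "\<dots> = (1 - \<sigma>) * g \<alpha> + \<sigma> * g (\<alpha> + \<beta>)"
    unfolding \<Psi>_def g_def using \<Phi>_int by simp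
  also have "\<dots> \<le> expectation (\<lambda>\<omega>. g (X i \<omega>))" by (rule le)
  also have "\<dots> = expectation (\<lambda>\<omega>. \<Phi> (\<Sum>j\<in>insert i N. X j \<omega>))"
    unfolding g_def using insert.hyps expectation_indep_add(2)[OF indep insert.prems(5,6)] by simp
  finally show ?case
    using N i insert.hyps(2) by (intro exI[of _ ?a] exI[of _ ?b] exI[of _ ?s]) auto
qed

theorem theorem1p3:
  fixes M :: "'a measure"
    and X :: "nat \<Rightarrow> 'a \<Rightarrow> real"
    and n :: nat
    and \<delta> :: real
  assumes "prob_space M"
    and "n \<ge> 1"
    and "prob_space.indep_vars M (\<lambda>_. borel) X {1..n}"
    and "\<And>i. i \<in> {1..n} \<Longrightarrow> AE \<omega> in M. 0 \<le> X i \<omega>"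
    and "\<And>i. i \<in> {1..n} \<Longrightarrow> integrable M (X i)"
    and "\<And>i. i \<in> {1..n} \<Longrightarrow> integral\<^sup>L M (X i) = 1"
    and "0 < \<delta>" and "\<delta> \<le> 1"
  shows "measure M {\<omega> \<in> space M. (\<Sum>i=1..n. X i \<omega>) < real n + \<delta>}
           \<ge> \<delta> * (real n / (real n + \<delta>)) ^ n"
proof -
  interpret prob_space M by fact
  let ?N = "{1..n}"
  define \<Phi> :: "real \<Rightarrow> real" where "\<Phi> = indicator {..<real n + \<delta>}"
  have "\<exists>a b s. (\<forall>i\<in>?N. 0 \<le> a i \<and> 0 < b i \<and> 0 \<le> s i \<and> s i < 1 \<and> a i + s i * b i = 1)
      \<and> (\<Sum>I\<in>Pow ?N. (\<Prod>i\<in>I. s i) * (\<Prod>i\<in>?N - I. 1 - s i) * \<Phi> (sum a ?N + sum b I))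
          \<le> expectation (\<lambda>\<omega>. \<Phi> (\<Sum>i\<in>?N. X i \<omega>))"
    by (rule two_point_reduction[where C = 1]) (use assms in \<open>auto simp: \<Phi>_def indicator_def\<close>)
  then obtain a b s where N: "\<And>i. i \<in> ?N \<Longrightarrow> 0 \<le> a i \<and> 0 < b i \<and> 0 \<le> s i \<and> s i < 1 \<and> a i + s i * b i = 1"
    and le: "(\<Sum>I\<in>Pow ?N. (\<Prod>i\<in>I. s i) * (\<Prod>i\<in>?N - I. 1 - s i) * \<Phi> (sum a ?N + sum b I))
          \<le> expectation (\<lambda>\<omega>. \<Phi> (\<Sum>i\<in>?N. X i \<omega>))"
    by blast
  \<comment> \<open>This is the threshold \<open>n + \<delta>\<close> lowered by the sum of the
    \<open>a i\<close>, since \<open>a i + s i * b i = 1\<close>.\<close>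
  define T where "T = \<delta> + (\<Sum>i\<in>?N. s i * b i)"
  have "sum a ?N + (\<Sum>i\<in>?N. s i * b i) = (\<Sum>i\<in>?N. 1)"
    unfolding sum.distrib[symmetric] by (rule sum.cong) (use N in auto)
  then have T: "sum a ?N + T = real n + \<delta>" by (simp add: T_def)
  interpret two_point_tilt ?N b s T
  proof
    show "0 < T"
      unfolding T_def using N \<open>0 < \<delta>\<close>
      by (intro add_pos_nonneg sum_nonneg mult_nonneg_nonneg) (auto intro: less_imp_le)
  qed (use N in auto)
  have [measurable]: "X i \<in> borel_measurable M" if "i \<in> ?N" for i
    using assms(5)[OF that] by simp
  have "\<delta> * (real n / (real n + \<delta>)) ^ n = \<delta> / (1 + \<delta> / card ?N) ^ card ?N"
  proof -
    have "real n / (real n + \<delta>) = 1 / (1 + \<delta> / n)"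
      using assms by (simp add: field_simps)
    then show ?thesis by (simp add: power_divide)
  qed
  also have "\<dots> \<le> below 0"
  proof (rule below_0_ge[OF \<open>0 < \<delta>\<close> \<open>\<delta> \<le> 1\<close> T_def])
    show "s i * b i \<le> 1" if "i \<in> ?N" for i
      using N[OF that] by linarith
  qed (use assms in simp)
  also have "\<dots> = (\<Sum>I\<in>Pow ?N. (\<Prod>i\<in>I. s i) * (\<Prod>i\<in>?N - I. 1 - s i) * \<Phi> (sum a ?N + sum b I))"
  proof -
    have \<Phi>: "\<Phi> (sum a ?N + sum b I) = (if sum b I < T then 1 else 0)" for I
      using T by (auto simp: \<Phi>_def indicator_def)
    show ?thesis
      unfolding below_0_eq A_def \<Phi> by (subst sum.inter_filter) (auto intro!: sum.cong)
  qed
  also have "\<dots> \<le> expectation (\<lambda>\<omega>. \<Phi> (\<Sum>i\<in>?N. X i \<omega>))" by (rule le)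
  also have "\<dots> = expectation (indicator {\<omega> \<in> space M. (\<Sum>i\<in>?N. X i \<omega>) < real n + \<delta>})"
    by (rule Bochner_Integration.integral_cong) (auto simp: \<Phi>_def indicator_def)
  also have "\<dots> = measure M {\<omega> \<in> space M. (\<Sum>i\<in>?N. X i \<omega>) < real n + \<delta>}"
    by simp
  finally show ?thesis .
qed

end
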